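(* Let $\varphi$ be a formula. Then: (1) $\varphi$ is a theorem of $\mathbf{E}$ iff $M\models\varphi$ for every preference model $M$ with finitely many worlds; (2) $\varphi$ is a theorem of $\mathbf{F}$ iff $M\models\varphi$ for every preference model $M$ with finitely many worlds whose relation $\succeq$ is acyclic; (3) $\varphi$ is a theorem of $\mathbf{F{+}(CM)}$ iff $M\models\varphi$ for every preference model $M$ with finitely many worlds whose relation $\succeq$ is transitive; (4) $\varphi$ is a theorem of $\mathbf{G}$ iff $M\models\varphi$ for every preference model $M$ with finitely many worlds whose relation $\succeq$ is transitive and total.
   Context: Formulas: $x\in\mathit{Var}\mid\neg\psi\mid\psi_1\wedge\psi_2\mid\Box\psi\mid\mathcal{O}(\psi_1\mid\psi_2)$. A preference model $M=\langle W,\succeq,\mathbb{V}\rangle$: $W$ nonempty, $\succeq$ binary relation on $W$, $\mathbb{V}\colon\mathit{Var}\to\mathcal{P}(W)$; $w_1\succ w_2$ iff $w_1\succeq w_2$ and not $w_2\succeq w_1$; $\max_\succ(U)=\{v\in U:\neg\exists u\in U,u\succ v\}$. Truth sets: $\|x\|=\mathbb{V}(x)$, $\|\neg\psi\|=W\setminus\|\psi\|$, $\|\psi_1\wedge\psi_2\|=\|\psi_1\|\cap\|\psi_2\|$, $\|\Box\beta\|=W$ if $\|\beta\|=W$ else $\emptyset$, $\|\mathcal{O}(\gamma\mid\alpha)\|=W$ if $\max_\succ(\|\alpha\|)\subseteq\|\gamma\|$ else $\emptyset$; $M\models\psi$ iff $\|\psi\|=W$. $M$ is limited if for every formula $\alpha$,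 $\|\alpha\|\neq\emptyset$ implies $\max_\succ(\|\alpha\|)\neq\emptyset$; smooth if for every formula $\alpha$ and $w\in\|\alpha\|$ there is $u\in\max_\succ(\|\alpha\|)$ with $u=w$ or $u\succ w$. $\succeq$ is total if for all $w_1,w_2$, $w_1\succeq w_2$ or $w_2\succeq w_1$; acyclic if there is no sequence $w_0\succeq w_1\succeq\dots\succeq w_k=w_0$ with $k\ge1$ (in particular it is irreflexive). Åqvist's logics are defined semantically: $\varphi$ is a theorem of $\mathbf{E}$ iff valid in all preference models; of $\mathbf{F}$ iff valid in all limited preference models; of $\mathbf{F{+}(CM)}$ iff valid in all smooth preference models with transitive $\succeq$; of $\mathbf{G}$ iff valid in all smooth preference models with transitive and total $\succeq$. *)

theory Defs
  imports Main "HOL-Library.Infinite_Typeclass"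
begin

datatype 'v fm =
    Atom 'v
  | Neg "'v fm"
  | And "'v fm" "'v fm"
  | Box "'v fm"
  | Ob "'v fm" "'v fm"  \<comment> \<open>\<open>Ob \<gamma> \<alpha>\<close> is \<open>O(\<gamma> | \<alpha>)\<close>: \<open>\<gamma>\<close> is obligatory given \<open>\<alpha>\<close>\<close>

record ('w, 'v) model =
  worlds :: "'w set"
  betters :: "('w \<times> 'w) set"  \<comment> \<open>\<open>(w, u) \<in> betters M\<close> means \<open>w \<succeq> u\<close>\<close>
  valuation :: "'v \<Rightarrow> 'w set"

definition preference_model :: "('w, 'v) model \<Rightarrow> bool" where
  "preference_model M \<longleftrightarrow>
     worlds M \<noteq> {} \<and>
     betters M \<subseteq> worlds M \<times> worlds M \<and>
     (\<forall>x. valuation M x \<subseteq> worlds M)"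

definition strictly_better :: "('w, 'v) model \<Rightarrow> 'w \<Rightarrow> 'w \<Rightarrow> bool" where
  "strictly_better M w u \<longleftrightarrow> (w, u) \<in> betters M \<and> (u, w) \<notin> betters M"

definition max_worlds :: "('w, 'v) model \<Rightarrow> 'w set \<Rightarrow> 'w set" where
  "max_worlds M U = {v \<in> U. \<not> (\<exists>u\<in>U. strictly_better M u v)}"

primrec truth_set :: "('w, 'v) model \<Rightarrow> 'v fm \<Rightarrow> 'w set" where
  "truth_set M (Atom x) = valuation M x"
| "truth_set M (Neg \<psi>) = worlds M - truth_set M \<psi>"
| "truth_set M (And \<psi>\<^sub>1 \<psi>\<^sub>2) = truth_set M \<psi>\<^sub>1 \<inter> truth_set M \<psi>\<^sub>2"
| "truth_set M (Box \<beta>) = (if truth_set M \<beta> = worlds M then worlds M else {})"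
| "truth_set M (Ob \<gamma> \<alpha>) =
     (if max_worlds M (truth_set M \<alpha>) \<subseteq> truth_set M \<gamma> then worlds M else {})"

definition models :: "('w, 'v) model \<Rightarrow> 'v fm \<Rightarrow> bool" (infix "\<Turnstile>" 50) where
  "M \<Turnstile> \<psi> \<longleftrightarrow> truth_set M \<psi> = worlds M"

definition limited :: "('w, 'v) model \<Rightarrow> bool" where
  "limited M \<longleftrightarrow>
     (\<forall>\<alpha>. truth_set M \<alpha> \<noteq> {} \<longrightarrow> max_worlds M (truth_set M \<alpha>) \<noteq> {})"

definition smooth :: "('w, 'v) model \<Rightarrow> bool" where
  "smooth M \<longleftrightarrow>
     (\<forall>\<alpha>. \<forall>w\<in>truth_set M \<alpha>. \<exists>u\<in>max_worlds M (truth_set M \<alpha>).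
        u = w \<or> strictly_better M u w)"

text \<open>
  The library's \<open>total_on\<close> only compares distinct elements; here a total relation is reflexive.
  Transitivity and acyclicity are the library's \<open>trans\<close> and \<open>acyclic\<close>, applied to \<open>betters M\<close>.
\<close>

definition total_model :: "('w, 'v) model \<Rightarrow> bool" where
  "total_model M \<longleftrightarrow>
     (\<forall>w\<^sub>1\<in>worlds M. \<forall>w\<^sub>2\<in>worlds M. (w\<^sub>1, w\<^sub>2) \<in> betters M \<or> (w\<^sub>2, w\<^sub>1) \<in> betters M)"

text \<open>
  HOL cannot quantify over all sets of worlds inside a formula, so theoremhood takes the type
  \<open>'w\<close> from which worlds are drawn as a parameter; the worlds of a model form an arbitrary
  nonempty subset of it. Results about these notions are to be stated for an arbitrary
  infinite \<open>'w\<close>: infinity ensures that models with any finite number of worlds are included.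
\<close>

definition theorem_E :: "'w itself \<Rightarrow> 'v fm \<Rightarrow> bool" where
  "theorem_E _ \<phi> \<longleftrightarrow> (\<forall>M :: ('w, 'v) model. preference_model M \<longrightarrow> M \<Turnstile> \<phi>)"

definition theorem_F :: "'w itself \<Rightarrow> 'v fm \<Rightarrow> bool" where
  "theorem_F _ \<phi> \<longleftrightarrow>
     (\<forall>M :: ('w, 'v) model. preference_model M \<and> limited M \<longrightarrow> M \<Turnstile> \<phi>)"

definition theorem_F_CM :: "'w itself \<Rightarrow> 'v fm \<Rightarrow> bool" where
  "theorem_F_CM _ \<phi> \<longleftrightarrow>
     (\<forall>M :: ('w, 'v) model.
        preference_model M \<and> smooth M \<and> trans (betters M) \<longrightarrow> M \<Turnstile> \<phi>)"

definition theorem_G :: "'w itself \<Rightarrow> 'v fm \<Rightarrow> bool" where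
  "theorem_G _ \<phi> \<longleftrightarrow>
     (\<forall>M :: ('w, 'v) model.
        preference_model M \<and> smooth M \<and> trans (betters M) \<and> total_model M \<longrightarrow> M \<Turnstile> \<phi>)"

end

(* A countermodel M of \<phi> is turned into a finite one whose worlds are labelled by worlds of M.
   By induction on subformulas, such a labelling preserves the truth of subformulas as soon as
   every subformula-type of M occurs as a label and, for each subformula \<alpha>, the types of the
   maximal \<alpha>-worlds are the same in both models. Limitedness and smoothness are needed for
   disjunctions of subformulas: they allow choosing greedily a finite list of worlds in which the
   first world satisfying \<alpha> is maximal in \<alpha> in M. *)

theory Submission
  imports Defs
begin

text \<open>The obstacle is that a non-maximal \<alpha>-world must still find a better
  \<alpha>-world once only finitely many worlds are left. Restricting the relation of M to finitely
  many representatives does not ensure this: a better world may be dropped, and the representative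
  of its type need not be better itself. Identifying worlds of equal type may collapse a strict
  ascent into a loop. So the labels are taken from M while the relation is built anew, and one world
  of M may label several new worlds. Two demands compete: non-maximal copies must be dominated, yet
  for every type of a maximal world some copy must stay undominated. The constructions reconcile
  them by cyclic copies in the general case, by layers in the acyclic case and by separate
  components in the transitive case. Only for total preorders is restriction enough.\<close>

section \<open>Subformulas, maximal worlds and disjunctions\<close>

primrec subfms :: "'v fm \<Rightarrow> 'v fm set" where
  "subfms (Atom x) = {Atom x}"
| "subfms (Neg \<psi>) = insert (Neg \<psi>) (subfms \<psi>)"
| "subfms (And \<psi> \<chi>) = insert (And \<psi> \<chi>) (subfms \<psi> \<union> subfms \<chi>)"
| "subfms (Box \<psi>) = insert (Box \<psi>) (subfms \<psi>)"
| "subfms (Ob \<gamma> \<alpha>) = insert (Ob \<gamma> \<alpha>) (subfms \<gamma> \<union> subfms \<alpha>)"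

lemma finite_subfms: "finite (subfms \<psi>)"
  by (induction \<psi>) auto

lemma subfms_refl: "\<psi> \<in> subfms \<psi>"
  by (cases \<psi>) auto

lemma truth_set_subset: "preference_model M \<Longrightarrow> truth_set M \<psi> \<subseteq> worlds M"
  by (induction \<psi>) (auto simp: preference_model_def)

lemma max_worlds_subset: "max_worlds M U \<subseteq> U"
  by (auto simp: max_worlds_def)

text \<open>A world maximal in a union of truth sets is thereby maximal in each member of the union
  that contains it. One choice of a world maximal in a disjunction can thus settle several
  subformulas at once.\<close>

lemma max_worlds_antimono: "v \<in> max_worlds M U \<Longrightarrow> v \<in> V \<Longrightarrow> V \<subseteq> U \<Longrightarrow> v \<in> max_worlds M V"
  by (auto simp: max_worlds_def)

lemma strictly_better_trans:
  "trans (betters M) \<Longrightarrow> strictly_better M u v \<Longrightarrow> strictly_better M v w \<Longrightarrow> strictly_better M u w"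
  unfolding strictly_better_def by (meson transD)

lemma strictly_better_worlds:
  "preference_model M \<Longrightarrow> strictly_better M u v \<Longrightarrow> u \<in> worlds M \<and> v \<in> worlds M"
  by (auto simp: preference_model_def strictly_better_def)

lemma strictly_better_if_asym:
  "asym (betters M) \<Longrightarrow> strictly_better M u v \<longleftrightarrow> (u, v) \<in> betters M"
  by (auto simp: strictly_better_def asym_iff)

text \<open>Limitedness and smoothness speak only of truth sets of formulas, so they reach a union
  only if some formula defines it. The disjunction is expressed by De Morgan.\<close>

lemma ex_Union_formula:
  assumes M: "preference_model M" and fin: "finite \<Delta>" and ne: "\<Delta> \<noteq> {}"
  shows "\<exists>\<delta>. truth_set M \<delta> = (\<Union>\<alpha>\<in>\<Delta>. truth_set M \<alpha>)"
  using fin ne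
proof (induction rule: finite_ne_induct)
  case (singleton \<alpha>)
  then show ?case by auto
next
  case (insert \<alpha> \<Delta>)
  then obtain \<delta> where \<delta>: "truth_set M \<delta> = (\<Union>\<alpha>\<in>\<Delta>. truth_set M \<alpha>)" by blast
  have "truth_set M (Neg (And (Neg \<alpha>) (Neg \<delta>))) = truth_set M \<alpha> \<union> truth_set M \<delta>"
    using truth_set_subset[OF M, of \<alpha>] truth_set_subset[OF M, of \<delta>] by auto
  then show ?case using \<delta> by (metis UN_insert)
qed

subsection \<open>Pulling a model back along a labelling of new worlds\<close>

definition pullback :: "('w, 'v) model \<Rightarrow> ('a \<Rightarrow> 'w) \<Rightarrow> 'a set \<Rightarrow> ('a \<times> 'a) set \<Rightarrow> ('a, 'v) model" where
  "pullback M f W r =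
     \<lparr>worlds = W, betters = r, valuation = \<lambda>x. {n \<in> W. f n \<in> valuation M x}\<rparr>"

lemma pullback_simps [simp]:
  "worlds (pullback M f W r) = W"
  "betters (pullback M f W r) = r"
  by (simp_all add: pullback_def)

lemma preference_model_pullback:
  "W \<noteq> {} \<Longrightarrow> r \<subseteq> W \<times> W \<Longrightarrow> preference_model (pullback M f W r)"
  by (auto simp: preference_model_def pullback_def)

definition agree :: "'v fm set \<Rightarrow> ('w, 'v) model \<Rightarrow> 'w \<Rightarrow> 'w \<Rightarrow> bool" where
  "agree S M u w \<longleftrightarrow> (\<forall>\<psi>\<in>S. u \<in> truth_set M \<psi> \<longleftrightarrow> w \<in> truth_set M \<psi>)"

text \<open>The hypotheses are stated for preimages of truth sets of M, which need no knowledge of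
  truth in the new model; in the \<open>Ob\<close> case the induction hypothesis identifies them
  with its truth sets. The requirements are asymmetric: a maximal new world must have a maximal
  label, but a maximal world of M need only be matched up to its type.\<close>

lemma truth_set_pullback:
  assumes M: "preference_model M"
    and f: "\<And>n. n \<in> W \<Longrightarrow> f n \<in> worlds M"
    and all: "\<And>w. w \<in> worlds M \<Longrightarrow> \<exists>n\<in>W. agree S M (f n) w"
    and sound: "\<And>\<alpha> n. \<alpha> \<in> S \<Longrightarrow>
       n \<in> max_worlds (pullback M f W r) {n \<in> W. f n \<in> truth_set M \<alpha>} \<Longrightarrow>
       f n \<in> max_worlds M (truth_set M \<alpha>)"
    and complete: "\<And>\<alpha> w. \<alpha> \<in> S \<Longrightarrow> w \<in> max_worlds M (truth_set M \<alpha>) \<Longrightarrow>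
       \<exists>n \<in> max_worlds (pullback M f W r) {n \<in> W. f n \<in> truth_set M \<alpha>}. agree S M (f n) w"
    and S: "subfms \<psi> \<subseteq> S"
  shows "truth_set (pullback M f W r) \<psi> = {n \<in> W. f n \<in> truth_set M \<psi>}"
  using S
proof (induction \<psi>)
  case (Atom x)
  then show ?case by (auto simp: pullback_def)
next
  case (Neg \<psi>)
  then show ?case using f by auto
next
  case (And \<psi> \<chi>)
  then show ?case by auto
next
  case (Box \<psi>)
  have "\<psi> \<in> S" using Box.prems subfms_refl[of \<psi>] by auto
  have "{n \<in> W. f n \<in> truth_set M \<psi>} = W \<longleftrightarrow> truth_set M \<psi> = worlds M"
  proof
    assume *: "{n \<in> W. f n \<in> truth_set M \<psi>} = W"
    have "w \<in> truth_set M \<psi>" if w: "w \<in> worlds M" for w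
      using all[OF w] * \<open>\<psi> \<in> S\<close> unfolding agree_def by blast
    then show "truth_set M \<psi> = worlds M" using truth_set_subset[OF M, of \<psi>] by blast
  qed (use f in auto)
  then show ?case using Box f by auto
next
  case (Ob \<gamma> \<alpha>)
  let ?N = "pullback M f W r"
  have mem: "\<gamma> \<in> S" "\<alpha> \<in> S" using Ob.prems subfms_refl[of \<gamma>] subfms_refl[of \<alpha>] by auto
  have eqs: "truth_set ?N \<gamma> = {n \<in> W. f n \<in> truth_set M \<gamma>}"
    "truth_set ?N \<alpha> = {n \<in> W. f n \<in> truth_set M \<alpha>}"
    using Ob by auto
  have "max_worlds ?N {n \<in> W. f n \<in> truth_set M \<alpha>} \<subseteq> {n \<in> W. f n \<in> truth_set M \<gamma>}
    \<longleftrightarrow> max_worlds M (truth_set M \<alpha>) \<subseteq> truth_set M \<gamma>"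
  proof
    assume *: "max_worlds ?N {n \<in> W. f n \<in> truth_set M \<alpha>} \<subseteq> {n \<in> W. f n \<in> truth_set M \<gamma>}"
    show "max_worlds M (truth_set M \<alpha>) \<subseteq> truth_set M \<gamma>"
    proof
      fix w assume "w \<in> max_worlds M (truth_set M \<alpha>)"
      from complete[OF mem(2) this] * mem(1) show "w \<in> truth_set M \<gamma>"
        unfolding agree_def by blast
    qed
  next
    assume *: "max_worlds M (truth_set M \<alpha>) \<subseteq> truth_set M \<gamma>"
    show "max_worlds ?N {n \<in> W. f n \<in> truth_set M \<alpha>} \<subseteq> {n \<in> W. f n \<in> truth_set M \<gamma>}"
    proof
      fix n assume n: "n \<in> max_worlds ?N {n \<in> W. f n \<in> truth_set M \<alpha>}"
      then have "n \<in> W" using max_worlds_subset[of ?N] by blast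
      then show "n \<in> {n \<in> W. f n \<in> truth_set M \<gamma>}" using sound[OF mem(2) n] * by blast
    qed
  qed
  then show ?case using eqs f by auto
qed

lemma models_pullback_iff:
  assumes M: "preference_model M"
    and f: "\<And>n. n \<in> W \<Longrightarrow> f n \<in> worlds M"
    and all: "\<And>w. w \<in> worlds M \<Longrightarrow> \<exists>n\<in>W. agree (subfms \<phi>) M (f n) w"
    and sound: "\<And>\<alpha> n. \<alpha> \<in> subfms \<phi> \<Longrightarrow>
       n \<in> max_worlds (pullback M f W r) {n \<in> W. f n \<in> truth_set M \<alpha>} \<Longrightarrow>
       f n \<in> max_worlds M (truth_set M \<alpha>)"
    and complete: "\<And>\<alpha> w. \<alpha> \<in> subfms \<phi> \<Longrightarrow> w \<in> max_worlds M (truth_set M \<alpha>) \<Longrightarrow>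
       \<exists>n \<in> max_worlds (pullback M f W r) {n \<in> W. f n \<in> truth_set M \<alpha>}.
         agree (subfms \<phi>) M (f n) w"
  shows "pullback M f W r \<Turnstile> \<phi> \<longleftrightarrow> M \<Turnstile> \<phi>"
proof -
  have eq: "truth_set (pullback M f W r) \<phi> = {n \<in> W. f n \<in> truth_set M \<phi>}"
    using truth_set_pullback[OF M f all sound complete order_refl] .
  show ?thesis
  proof
    assume "pullback M f W r \<Turnstile> \<phi>"
    then have *: "n \<in> W \<Longrightarrow> f n \<in> truth_set M \<phi>" for n
      using eq unfolding models_def by auto
    have "w \<in> truth_set M \<phi>" if w: "w \<in> worlds M" for w
      using all[OF w] * subfms_refl[of \<phi>] unfolding agree_def by blast
    then show "M \<Turnstile> \<phi>" using truth_set_subset[OF M, of \<phi>] unfolding models_def by blast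
  next
    assume "M \<Turnstile> \<phi>"
    then show "pullback M f W r \<Turnstile> \<phi>" using eq f unfolding models_def by auto
  qed
qed

text \<open>The constructions below take their worlds from products or from a datatype, whereas the
  theorem allows any infinite type. A finite model can be renamed along a bijection with a finite
  subset of the target type.\<close>

lemma ex_finite_copy:
  fixes N :: "('a, 'v) model"
  assumes N: "preference_model N" and fin: "finite (worlds N)"
  obtains N' :: "('u::infinite, 'v) model" where
    "preference_model N'" "finite (worlds N')"
    "\<And>\<phi>. N' \<Turnstile> \<phi> \<longleftrightarrow> N \<Turnstile> \<phi>"
    "acyclic (betters N) \<Longrightarrow> acyclic (betters N')"
    "trans (betters N) \<Longrightarrow> trans (betters N')"
    "total_model N \<Longrightarrow> total_model N'"
proof -
  let ?W = "worlds N"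
  obtain V :: "'u set" where V: "finite V" "card V = card ?W"
    using infinite_arbitrarily_large[OF infinite_UNIV] by blast
  then obtain h where h: "bij_betw h V ?W"
    using finite_same_card_bij[OF V(1) fin] by blast
  define r where "r = inv_image (betters N) h \<inter> V \<times> V"
  let ?N' = "pullback N h V r"
  have hW: "h v \<in> ?W" if "v \<in> V" for v using h that by (auto simp: bij_betw_def)
  have hV: "\<exists>v\<in>V. h v = w" if "w \<in> ?W" for w
    using that bij_betw_imp_surj_on[OF h] by (metis imageE)
  have sb: "strictly_better ?N' u v \<longleftrightarrow> strictly_better N (h u) (h v)" if "u \<in> V" "v \<in> V" for u v
    using that by (auto simp: strictly_better_def r_def)
  have mx: "v \<in> max_worlds ?N' {n \<in> V. h n \<in> U} \<longleftrightarrow> h v \<in> max_worlds N U"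
    if "v \<in> V" "U \<subseteq> ?W" for v U
  proof -
    have "(\<exists>u\<in>{n \<in> V. h n \<in> U}. strictly_better ?N' u v) \<longleftrightarrow> (\<exists>u\<in>U. strictly_better N u (h v))"
    proof
      assume "\<exists>u\<in>U. strictly_better N u (h v)"
      then obtain u where u: "u \<in> U" "strictly_better N u (h v)" by blast
      then obtain n where "n \<in> V" "h n = u" using hV \<open>U \<subseteq> ?W\<close> by blast
      then show "\<exists>u\<in>{n \<in> V. h n \<in> U}. strictly_better ?N' u v" using u sb that(1) by blast
    qed (use sb that(1) in blast)
    then show ?thesis using that(1) by (simp only: max_worlds_def mem_Collect_eq simp_thms)
  qed
  show thesis
  proof
    have "V \<noteq> {}" using V fin N by (auto simp: preference_model_def)
    then show "preference_model ?N'"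
      by (intro preference_model_pullback) (auto simp: r_def)
    show "finite (worlds ?N')" using V by simp
    show "?N' \<Turnstile> \<phi> \<longleftrightarrow> N \<Turnstile> \<phi>" for \<phi>
    proof (rule models_pullback_iff[OF N])
      fix \<alpha> v assume *: "v \<in> max_worlds ?N' {n \<in> V. h n \<in> truth_set N \<alpha>}"
      then have "v \<in> V" using max_worlds_subset[of ?N'] by blast
      then show "h v \<in> max_worlds N (truth_set N \<alpha>)"
        using mx[OF _ truth_set_subset[OF N]] * by blast
    next
      fix \<alpha> w assume *: "w \<in> max_worlds N (truth_set N \<alpha>)"
      then have "w \<in> ?W" using max_worlds_subset[of N] truth_set_subset[OF N] by blast
      then obtain v where "v \<in> V" "h v = w" using hV by blast
      then show "\<exists>n\<in>max_worlds ?N' {n \<in> V. h n \<in> truth_set N \<alpha>}. agree (subfms \<phi>) N (h n) w"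
        using mx[OF _ truth_set_subset[OF N]] * by (auto simp: agree_def)
    qed (use hW hV in \<open>auto simp: agree_def\<close>)
    show "acyclic (betters ?N')" if "acyclic (betters N)"
    proof -
      have "finite (betters N)"
        using N fin unfolding preference_model_def by (meson finite_SigmaI finite_subset)
      \<comment> \<open>For finite relations acyclicity is well-foundedness, and the latter passes
        to inverse images.\<close>
      then have "wf (betters N)" using that by (simp add: finite_acyclic_wf)
      then have "wf r" using wf_subset[OF wf_inv_image[of _ h], of "betters N" r] by (simp add: r_def)
      then show ?thesis by (simp add: wf_acyclic)
    qed
    show "trans (betters ?N')" if "trans (betters N)"
      unfolding pullback_simps
    proof (rule transI)
      fix a b c assume "(a, b) \<in> r" "(b, c) \<in> r"
      then show "(a, c) \<in> r" using transD[OF that, of "h a" "h b" "h c"] by (simp add: r_def)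
    qed
    show "total_model ?N'" if "total_model N"
      using that hW by (auto simp: total_model_def r_def)
  qed
qed

subsection \<open>Finite models are limited or smooth\<close>

lemma limited_if_finite_acyclic:
  assumes M: "preference_model M" and fin: "finite (worlds M)" and ac: "acyclic (betters M)"
  shows "limited M"
  unfolding limited_def
proof (intro allI impI)
  fix \<alpha> assume ne: "truth_set M \<alpha> \<noteq> {}"
  have "finite (betters M)"
    using M fin unfolding preference_model_def by (meson finite_SigmaI finite_subset)
  then have "wf (betters M)" using ac by (simp add: finite_acyclic_wf)
  \<comment> \<open>The better world stands on the left of a pair in \<open>betters M\<close>, so an
    element minimal for the well-founded relation is a maximal world.\<close>
  then obtain z where "z \<in> truth_set M \<alpha>" "\<And>y. (y, z) \<in> betters M \<Longrightarrow> y \<notin> truth_set M \<alpha>"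
    using ne wfE_min' by metis
  then show "max_worlds M (truth_set M \<alpha>) \<noteq> {}"
    by (auto simp: max_worlds_def strictly_better_def)
qed

lemma smooth_if_finite_trans:
  assumes M: "preference_model M" and fin: "finite (worlds M)" and tr: "trans (betters M)"
  shows "smooth M"
  unfolding smooth_def
proof (intro allI ballI)
  fix \<alpha> w assume w: "w \<in> truth_set M \<alpha>"
  \<comment> \<open>\<open>betters M\<close> may contain cycles, for instance reflexive pairs; its
    strict part cannot.\<close>
  let ?r = "{(u, v). strictly_better M u v}"
  \<comment> \<open>A best element of \<open>?U\<close> is best in all of \<alpha>: by transitivity,
    any better \<alpha>-world is above \<open>w\<close> too and so lies in
    \<open>?U\<close>.\<close>
  let ?U = "{u \<in> truth_set M \<alpha>. u = w \<or> strictly_better M u w}"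
  have "?r \<subseteq> worlds M \<times> worlds M" using strictly_better_worlds[OF M] by blast
  then have "finite ?r" using fin by (meson finite_SigmaI finite_subset)
  moreover have "trans ?r" using strictly_better_trans[OF tr] by (auto intro: transI)
  then have "acyclic ?r"
    by (auto simp: acyclic_def strictly_better_def)
  ultimately have "wf ?r" by (simp add: finite_acyclic_wf)
  moreover have "?U \<noteq> {}" using w by blast
  ultimately obtain z where z: "z \<in> ?U" "\<And>y. strictly_better M y z \<Longrightarrow> y \<notin> ?U"
    using wfE_min'[of ?r ?U] by auto
  have "z \<in> max_worlds M (truth_set M \<alpha>)"
    using z strictly_better_trans[OF tr, of _ z w] unfolding max_worlds_def by blast
  then show "\<exists>u\<in>max_worlds M (truth_set M \<alpha>). u = w \<or> strictly_better M u w"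
    using z by blast
qed

subsection \<open>Representatives and greedy chains\<close>

text \<open>Maximality is recorded besides truth because worlds satisfying the same formulas may
  differ in the formulas in which they are maximal. A finite \<open>S\<close> leaves only finitely
  many such pairs of subsets.\<close>

lemma ex_representatives:
  assumes "finite S"
  obtains R where "finite R" "R \<subseteq> worlds M"
    "\<And>w. w \<in> worlds M \<Longrightarrow> \<exists>u\<in>R. agree S M u w \<and>
       (\<forall>\<alpha>\<in>S. u \<in> max_worlds M (truth_set M \<alpha>) \<longleftrightarrow> w \<in> max_worlds M (truth_set M \<alpha>))"
proof -
  let ?t = "\<lambda>w. ({\<psi> \<in> S. w \<in> truth_set M \<psi>}, {\<alpha> \<in> S. w \<in> max_worlds M (truth_set M \<alpha>)})"
  have "?t ` worlds M \<subseteq> Pow S \<times> Pow S" by auto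
  then have "finite (?t ` worlds M)" using assms by (meson finite_Pow_iff finite_SigmaI finite_subset)
  then obtain R where R: "R \<subseteq> worlds M" "finite R" "?t ` worlds M = ?t ` R"
    using finite_subset_image[of "?t ` worlds M" ?t "worlds M"] by blast
  show thesis
  proof
    fix w assume "w \<in> worlds M"
    then have "?t w \<in> ?t ` R" unfolding R(3)[symmetric] by (rule imageI)
    then obtain u where "u \<in> R" "?t w = ?t u" by (elim imageE)
    then show "\<exists>u\<in>R. agree S M u w \<and>
       (\<forall>\<alpha>\<in>S. u \<in> max_worlds M (truth_set M \<alpha>) \<longleftrightarrow> w \<in> max_worlds M (truth_set M \<alpha>))"
      unfolding agree_def by (intro bexI[of _ u]) auto
  qed (use R in auto)
qed

text \<open>
  A world of the list that is maximal in \<open>\<alpha>\<close> for the linear order of the list is the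
  first one in \<open>\<alpha>\<close>; greedy choice makes it maximal in the original model as well.
\<close>

lemma ex_greedy_chain:
  assumes "finite \<Delta>"
    and "\<forall>\<Gamma>\<subseteq>\<Delta>. \<Gamma> \<noteq> {} \<longrightarrow> (\<exists>v\<in>P. v \<in> max_worlds M (\<Union>\<alpha>\<in>\<Gamma>. truth_set M \<alpha>))"
  shows "\<exists>vs. set vs \<subseteq> P \<and> (\<forall>\<alpha>\<in>\<Delta>. \<exists>i<length vs. vs ! i \<in> truth_set M \<alpha>) \<and>
    (\<forall>i<length vs. \<forall>\<alpha>\<in>\<Delta>. vs ! i \<in> truth_set M \<alpha> \<longrightarrow> (\<forall>j<i. vs ! j \<notin> truth_set M \<alpha>) \<longrightarrow>
       vs ! i \<in> max_worlds M (truth_set M \<alpha>))"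
  using assms
proof (induction rule: finite_psubset_induct)
  case (psubset \<Delta>)
  show ?case
  proof (cases "\<Delta> = {}")
    case True
    then show ?thesis by (intro exI[of _ "[]"]) auto
  next
    case False
    then obtain v where v: "v \<in> P" "v \<in> max_worlds M (\<Union>\<alpha>\<in>\<Delta>. truth_set M \<alpha>)"
      using psubset.prems by blast
    \<comment> \<open>The formulas true at \<open>v\<close> are settled, as \<open>v\<close> is
      their first world and is maximal in each of them by antitonicity. The rest of the list only
      has to serve the formulas that fail at \<open>v\<close>.\<close>
    let ?\<Gamma> = "{\<alpha> \<in> \<Delta>. v \<notin> truth_set M \<alpha>}"
    have "v \<in> (\<Union>\<alpha>\<in>\<Delta>. truth_set M \<alpha>)" using v(2) max_worlds_subset[of M] by blast
    then have sub: "?\<Gamma> \<subset> \<Delta>" by blast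
    have *: "\<forall>\<Gamma>'\<subseteq>?\<Gamma>. \<Gamma>' \<noteq> {} \<longrightarrow> (\<exists>v\<in>P. v \<in> max_worlds M (\<Union>\<alpha>\<in>\<Gamma>'. truth_set M \<alpha>))"
      using psubset.prems by blast
    obtain vs where vs: "set vs \<subseteq> P"
      "\<forall>\<alpha>\<in>?\<Gamma>. \<exists>i<length vs. vs ! i \<in> truth_set M \<alpha>"
      "\<forall>i<length vs. \<forall>\<alpha>\<in>?\<Gamma>. vs ! i \<in> truth_set M \<alpha> \<longrightarrow> (\<forall>j<i. vs ! j \<notin> truth_set M \<alpha>) \<longrightarrow>
         vs ! i \<in> max_worlds M (truth_set M \<alpha>)"
      using psubset.IH[OF sub *] by (elim exE conjE) (rule that)
    show ?thesis
    proof (intro exI[of _ "v # vs"] conjI ballI allI impI)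
      show "set (v # vs) \<subseteq> P" using v vs by auto
    next
      fix \<alpha> assume \<alpha>: "\<alpha> \<in> \<Delta>"
      show "\<exists>i<length (v # vs). (v # vs) ! i \<in> truth_set M \<alpha>"
      proof (cases "v \<in> truth_set M \<alpha>")
        case True
        then show ?thesis by (intro exI[of _ 0]) simp
      next
        case False
        then obtain i where "i < length vs" "vs ! i \<in> truth_set M \<alpha>" using vs(2) \<alpha> by blast
        then show ?thesis by (intro exI[of _ "Suc i"]) simp
      qed
    next
      fix i \<alpha> assume *: "i < length (v # vs)" "\<alpha> \<in> \<Delta>" "(v # vs) ! i \<in> truth_set M \<alpha>"
        "\<forall>j<i. (v # vs) ! j \<notin> truth_set M \<alpha>"
      show "(v # vs) ! i \<in> max_worlds M (truth_set M \<alpha>)"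
      proof (cases i)
        case 0
        then show ?thesis using * v(2) by (auto intro: max_worlds_antimono)
      next
        case (Suc k)
        have "v \<notin> truth_set M \<alpha>" using *(4)[rule_format, of 0] Suc by simp
        moreover have "vs ! j \<notin> truth_set M \<alpha>" if "j < k" for j
          using *(4)[rule_format, of "Suc j"] Suc that by simp
        ultimately show ?thesis using vs(3) * Suc by auto
      qed
    qed
  qed
qed


subsection \<open>Finite countermodels\<close>

text \<open>
  A representative \<open>u\<close> may be placed above \<open>w\<close> without harm if no formula in which \<open>w\<close> is
  maximal holds at \<open>u\<close>. Three copies of each representative, ordered cyclically, keep this
  relation asymmetric.
\<close>

lemma finite_countermodel:
  fixes M :: "('w, 'v) model"
  assumes M: "preference_model M" and neg: "\<not> M \<Turnstile> \<phi>"
  obtains N :: "('w \<times> nat, 'v) model" where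
    "preference_model N" "finite (worlds N)" "\<not> N \<Turnstile> \<phi>"
proof -
  let ?S = "subfms \<phi>" and ?T = "truth_set M"
  obtain R where R: "finite R" "R \<subseteq> worlds M"
    "\<And>w. w \<in> worlds M \<Longrightarrow> \<exists>u\<in>R. agree ?S M u w \<and>
       (\<forall>\<alpha>\<in>?S. u \<in> max_worlds M (?T \<alpha>) \<longleftrightarrow> w \<in> max_worlds M (?T \<alpha>))"
    using ex_representatives[OF finite_subfms] by metis
  define W where "W = R \<times> {..<3::nat}"
  define r where "r = {((u, j), (w, i)). (u, j) \<in> W \<and> (w, i) \<in> W \<and> j = (i + 1) mod 3 \<and>
    (\<forall>\<alpha>\<in>?S. w \<in> max_worlds M (?T \<alpha>) \<longrightarrow> u \<notin> ?T \<alpha>)}"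
  let ?N = "pullback M fst W r"
  have "asym r"
  proof (rule asymI, clarify)
    fix u j w i assume "((u, j), (w, i)) \<in> r" "((w, i), (u, j)) \<in> r"
    then have "j = (i + 1) mod 3" "i = (j + 1) mod 3" by (auto simp: r_def)
    \<comment> \<open>The two equations give \<open>i = (i + 2) mod 3\<close>, which is impossible;
      with one or two copies the cyclic successor would be a symmetric relation.\<close>
    then show False by presburger
  qed
  then have sb: "strictly_better ?N m n \<longleftrightarrow> (m, n) \<in> r" for m n
    by (simp add: strictly_better_if_asym)
  show thesis
  proof
    have "R \<noteq> {}" using R(3) M by (auto simp: preference_model_def)
    then have "W \<noteq> {}" by (simp add: W_def lessThan_empty_iff)
    then show "preference_model ?N"
      by (intro preference_model_pullback) (auto simp: r_def)
    show "finite (worlds ?N)" using R(1) by (simp add: W_def)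
    have "?N \<Turnstile> \<phi> \<longleftrightarrow> M \<Turnstile> \<phi>"
    proof (rule models_pullback_iff[OF M])
      fix n assume "n \<in> W" then show "fst n \<in> worlds M" using R(2) by (auto simp: W_def)
    next
      fix w assume "w \<in> worlds M"
      then obtain u where "u \<in> R" "agree ?S M u w" using R(3) by blast
      then show "\<exists>n\<in>W. agree ?S M (fst n) w" by (intro bexI[of _ "(u, 0)"]) (auto simp: W_def)
    next
      fix \<alpha> n assume \<alpha>: "\<alpha> \<in> ?S" and n: "n \<in> max_worlds ?N {n \<in> W. fst n \<in> ?T \<alpha>}"
      obtain w i where wi: "n = (w, i)" by (cases n)
      have w: "(w, i) \<in> W" "w \<in> ?T \<alpha>" using n by (auto simp: wi max_worlds_def)
      show "fst n \<in> max_worlds M (?T \<alpha>)"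
      proof (rule ccontr)
        assume "fst n \<notin> max_worlds M (?T \<alpha>)"
        then obtain x where x: "x \<in> ?T \<alpha>" "strictly_better M x w"
          using w by (auto simp: wi max_worlds_def)
        then obtain u where u: "u \<in> R" "agree ?S M u x"
          using R(3) strictly_better_worlds[OF M] by blast
        \<comment> \<open>A formula in which \<open>w\<close> is maximal fails at the strictly
          better world \<open>x\<close>, hence also at \<open>u\<close>, which agrees with
          \<open>x\<close> on subformulas.\<close>
        have "u \<notin> ?T \<beta>" if "\<beta> \<in> ?S" "w \<in> max_worlds M (?T \<beta>)" for \<beta>
          using that u(2) x(2) unfolding agree_def max_worlds_def by blast
        then have "((u, (i + 1) mod 3), (w, i)) \<in> r" using w(1) u(1) by (auto simp: r_def W_def)
        moreover have "u \<in> ?T \<alpha>" using u(2) x(1) \<alpha> unfolding agree_def by blast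
        moreover have "(u, (i + 1) mod 3) \<in> W" using u(1) by (simp add: W_def)
        ultimately show False using n unfolding wi max_worlds_def sb by force
      qed
    next
      fix \<alpha> w assume \<alpha>: "\<alpha> \<in> ?S" and w: "w \<in> max_worlds M (?T \<alpha>)"
      then have "w \<in> worlds M" using max_worlds_subset[of M] truth_set_subset[OF M] by blast
      then obtain u where u: "u \<in> R" "agree ?S M u w" "u \<in> max_worlds M (?T \<alpha>)"
        using R(3) w \<alpha> by blast
      then have "u \<in> ?T \<alpha>" using max_worlds_subset[of M] by blast
      then have "(u, 0) \<in> max_worlds ?N {n \<in> W. fst n \<in> ?T \<alpha>}"
        using u \<alpha> unfolding max_worlds_def[of ?N] sb by (auto simp: r_def W_def)
      then show "\<exists>n\<in>max_worlds ?N {n \<in> W. fst n \<in> ?T \<alpha>}. agree ?S M (fst n) w"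
        using u(2) by force
    qed
    then show "\<not> ?N \<Turnstile> \<phi>" using neg by simp
  qed
qed

datatype ('w, 'v) layered = Chain nat | Helper 'w | Test 'w "'v fm"

text \<open>
  Only test worlds \<open>Test w \<kappa>\<close>, with \<open>w\<close> maximal in \<open>\<kappa>\<close>, have to witness maximality. The
  helpers above such a world are the ones outside \<open>\<kappa>\<close>, so if it is maximal in \<open>\<alpha>\<close>, then \<open>\<alpha>\<close>
  entails \<open>\<kappa>\<close> and \<open>w\<close> is maximal in \<open>\<alpha>\<close> as well. The chain lies above every
  helper and meets every satisfiable subformula, so helpers are maximal in nothing.
\<close>

lemma finite_acyclic_countermodel:
  fixes M :: "('w, 'v) model"
  assumes M: "preference_model M" and lim: "limited M" and neg: "\<not> M \<Turnstile> \<phi>"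
  obtains N :: "(('w, 'v) layered, 'v) model" where
    "preference_model N" "finite (worlds N)" "acyclic (betters N)" "\<not> N \<Turnstile> \<phi>"
proof -
  let ?S = "subfms \<phi>" and ?T = "truth_set M"
  obtain R where R: "finite R" "R \<subseteq> worlds M"
    "\<And>w. w \<in> worlds M \<Longrightarrow> \<exists>u\<in>R. agree ?S M u w \<and>
       (\<forall>\<alpha>\<in>?S. u \<in> max_worlds M (?T \<alpha>) \<longleftrightarrow> w \<in> max_worlds M (?T \<alpha>))"
    using ex_representatives[OF finite_subfms] by metis
  let ?\<Delta> = "{\<alpha> \<in> ?S. ?T \<alpha> \<noteq> {}}"
  have fin\<Delta>: "finite ?\<Delta>" using finite_subfms[of \<phi>] by simp
  have "\<forall>\<Gamma>\<subseteq>?\<Delta>. \<Gamma> \<noteq> {} \<longrightarrow> (\<exists>v\<in>worlds M. v \<in> max_worlds M (\<Union>\<alpha>\<in>\<Gamma>. ?T \<alpha>))"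
  proof (intro allI impI)
    fix \<Gamma> assume \<Gamma>: "\<Gamma> \<subseteq> ?\<Delta>" "\<Gamma> \<noteq> {}"
    then obtain \<delta> where \<delta>: "?T \<delta> = (\<Union>\<alpha>\<in>\<Gamma>. ?T \<alpha>)"
      using ex_Union_formula[OF M finite_subset[OF _ fin\<Delta>]] by blast
    then have "?T \<delta> \<noteq> {}" using \<Gamma> by blast
    then obtain v where "v \<in> max_worlds M (?T \<delta>)" using lim unfolding limited_def by blast
    then show "\<exists>v\<in>worlds M. v \<in> max_worlds M (\<Union>\<alpha>\<in>\<Gamma>. ?T \<alpha>)"
      using \<delta> max_worlds_subset[of M] truth_set_subset[OF M, of \<delta>] by (metis subsetD)
  qed
  from ex_greedy_chain[OF fin\<Delta> this] obtain vs where vs: "set vs \<subseteq> worlds M"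
    "\<And>\<alpha>. \<alpha> \<in> ?S \<Longrightarrow> ?T \<alpha> \<noteq> {} \<Longrightarrow> \<exists>i<length vs. vs ! i \<in> ?T \<alpha>"
    "\<And>i \<alpha>. i < length vs \<Longrightarrow> \<alpha> \<in> ?S \<Longrightarrow> vs ! i \<in> ?T \<alpha> \<Longrightarrow> \<forall>j<i. vs ! j \<notin> ?T \<alpha> \<Longrightarrow>
       vs ! i \<in> max_worlds M (?T \<alpha>)"
    by blast
  define f :: "('w, 'v) layered \<Rightarrow> 'w" where
    "f = case_layered (\<lambda>i. vs ! i) (\<lambda>u. u) (\<lambda>w \<kappa>. w)"
  have f [simp]: "f (Chain i) = vs ! i" "f (Helper u) = u" "f (Test w \<kappa>) = w" for i u w \<kappa>
    by (simp_all add: f_def)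
  define W :: "('w, 'v) layered set" where
    "W = Chain ` {..<length vs} \<union> Helper ` R \<union>
       {Test w \<kappa> | w \<kappa>. w \<in> R \<and> \<kappa> \<in> ?S \<and> w \<in> max_worlds M (?T \<kappa>)}"
  \<comment> \<open>The relation must not be closed under transitivity: were the whole chain above
    the test worlds, no test world would be maximal in any subformula, since the chain meets all the
    satisfiable ones.\<close>
  define r :: "('w, 'v) layered rel" where
    "r = {(Chain i, Chain j) | i j. i < j \<and> j < length vs} \<union>
       {(Chain i, Helper u) | i u. i < length vs \<and> u \<in> R} \<union>
       {(Helper u, Test w \<kappa>) | u w \<kappa>. u \<in> R \<and> w \<in> R \<and> \<kappa> \<in> ?S \<and>
          w \<in> max_worlds M (?T \<kappa>) \<and> u \<notin> ?T \<kappa>}"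
  let ?N = "pullback M f W r"
  \<comment> \<open>The rank grows from better to worse: chain worlds by index, then all helpers,
    then all test worlds.\<close>
  have "r \<subseteq> measure (case_layered (\<lambda>i. i) (\<lambda>u. length vs) (\<lambda>w \<kappa>. Suc (length vs)))"
    by (auto simp: r_def)
  then have wf: "wf r" using wf_subset[OF wf_measure] by blast
  then have sb: "strictly_better ?N m n \<longleftrightarrow> (m, n) \<in> r" for m n
    by (simp add: strictly_better_if_asym wf_imp_asym)
  show thesis
  proof
    have "R \<noteq> {}" using R(3) M by (auto simp: preference_model_def)
    then show "preference_model ?N"
      by (intro preference_model_pullback) (auto simp: W_def r_def)
    have "{Test w \<kappa> | w \<kappa>. w \<in> R \<and> \<kappa> \<in> ?S \<and> w \<in> max_worlds M (?T \<kappa>)}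
      \<subseteq> (\<lambda>(w, \<kappa>). Test w \<kappa>) ` (R \<times> ?S)" by auto
    then have "finite {Test w \<kappa> | w \<kappa>. w \<in> R \<and> \<kappa> \<in> ?S \<and> w \<in> max_worlds M (?T \<kappa>)}"
      using R(1) finite_subfms[of \<phi>] by (meson finite_SigmaI finite_imageI finite_subset)
    then show "finite (worlds ?N)" using R(1) by (simp add: W_def)
    show "acyclic (betters ?N)" using wf by (simp add: wf_acyclic)
    have "?N \<Turnstile> \<phi> \<longleftrightarrow> M \<Turnstile> \<phi>"
    proof (rule models_pullback_iff[OF M])
      fix n assume "n \<in> W"
      then show "f n \<in> worlds M" using R(2) vs(1) by (auto simp: W_def)
    next
      fix w assume "w \<in> worlds M"
      then obtain u where "u \<in> R" "agree ?S M u w" using R(3) by blast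
      then show "\<exists>n\<in>W. agree ?S M (f n) w" by (intro bexI[of _ "Helper u"]) (auto simp: W_def)
    next
      fix \<alpha> n assume \<alpha>: "\<alpha> \<in> ?S" and n: "n \<in> max_worlds ?N {n \<in> W. f n \<in> ?T \<alpha>}"
      then have nW: "n \<in> W" and n\<alpha>: "f n \<in> ?T \<alpha>" using max_worlds_subset[of ?N] by blast+
      have nmax: "f m \<notin> ?T \<alpha>" if "m \<in> W" "(m, n) \<in> r" for m
        using n that by (auto simp: max_worlds_def sb)
      show "f n \<in> max_worlds M (?T \<alpha>)"
      proof (cases n)
        case (Chain i)
        then have i: "i < length vs" using nW by (auto simp: W_def)
        have "\<forall>j<i. vs ! j \<notin> ?T \<alpha>"
          using nmax[of "Chain _"] i Chain by (auto simp: W_def r_def)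
        then show ?thesis using vs(3)[OF i \<alpha>] n\<alpha> Chain by simp
      next
        case (Helper u)
        obtain i where i: "i < length vs" "vs ! i \<in> ?T \<alpha>" using vs(2)[OF \<alpha>] n\<alpha> by blast
        then show ?thesis using nmax[of "Chain i"] nW Helper by (auto simp: W_def r_def)
      next
        case (Test w \<kappa>)
        then have w: "w \<in> R" "\<kappa> \<in> ?S" "w \<in> max_worlds M (?T \<kappa>)" using nW by (auto simp: W_def)
        have *: "u \<in> ?T \<kappa>" if "u \<in> R" "u \<in> ?T \<alpha>" for u
          using nmax[of "Helper u"] that w Test by (auto simp: W_def r_def)
        have "x \<in> ?T \<kappa>" if x: "x \<in> ?T \<alpha>" for x
        proof -
          have "x \<in> worlds M" using x truth_set_subset[OF M] by blast
          then obtain u where "u \<in> R" "agree ?S M u x" using R(3) by blast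
          then show ?thesis using * x \<alpha> w(2) unfolding agree_def by blast
        qed
        then show ?thesis using max_worlds_antimono[OF w(3)] n\<alpha> Test by auto
      qed
    next
      fix \<alpha> w assume \<alpha>: "\<alpha> \<in> ?S" and w: "w \<in> max_worlds M (?T \<alpha>)"
      then have "w \<in> worlds M" using max_worlds_subset[of M] truth_set_subset[OF M] by blast
      then obtain u where u: "u \<in> R" "agree ?S M u w" "u \<in> max_worlds M (?T \<alpha>)"
        using R(3) w \<alpha> by blast
      then have "u \<in> ?T \<alpha>" using max_worlds_subset[of M] by blast
      \<comment> \<open>Indexing the test world by \<alpha> itself leaves only helpers outside
        \<alpha> above it.\<close>
      then have "Test u \<alpha> \<in> max_worlds ?N {n \<in> W. f n \<in> ?T \<alpha>}"
        using u \<alpha> unfolding max_worlds_def[of ?N] sb by (auto simp: r_def W_def)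
      then show "\<exists>n\<in>max_worlds ?N {n \<in> W. f n \<in> ?T \<alpha>}. agree ?S M (f n) w"
        using u(2) by force
    qed
    then show "\<not> ?N \<Turnstile> \<phi>" using neg by simp
  qed
qed

text \<open>
  Disjoint union of linear orders: below each representative's greedy chain of better worlds
  comes the representative itself.
\<close>

lemma finite_trans_countermodel:
  fixes M :: "('w, 'v) model"
  assumes M: "preference_model M" and smooth: "smooth M" and tr: "trans (betters M)"
    and neg: "\<not> M \<Turnstile> \<phi>"
  obtains N :: "('w \<times> nat, 'v) model" where
    "preference_model N" "finite (worlds N)" "trans (betters N)" "\<not> N \<Turnstile> \<phi>"
proof -
  let ?S = "subfms \<phi>" and ?T = "truth_set M"
  obtain R where R: "finite R" "R \<subseteq> worlds M"
    "\<And>w. w \<in> worlds M \<Longrightarrow> \<exists>u\<in>R. agree ?S M u w \<and>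
       (\<forall>\<alpha>\<in>?S. u \<in> max_worlds M (?T \<alpha>) \<longleftrightarrow> w \<in> max_worlds M (?T \<alpha>))"
    using ex_representatives[OF finite_subfms] by metis
  \<comment> \<open>An \<alpha>-world \<open>w\<close> is maximal in the subformula \<alpha> exactly
    when \<alpha> is not in this set, so a chain meeting all of the set dominates \<open>w\<close>
    just where it should.\<close>
  let ?\<Delta> = "\<lambda>w. {\<alpha> \<in> ?S. \<exists>u\<in>?T \<alpha>. strictly_better M u w}"
  define chain where "chain w vs \<longleftrightarrow> set vs \<subseteq> {v. strictly_better M v w} \<and>
    (\<forall>\<alpha>\<in>?\<Delta> w. \<exists>i<length vs. vs ! i \<in> ?T \<alpha>) \<and>
    (\<forall>i<length vs. \<forall>\<alpha>\<in>?\<Delta> w. vs ! i \<in> ?T \<alpha> \<longrightarrow> (\<forall>j<i. vs ! j \<notin> ?T \<alpha>) \<longrightarrow>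
       vs ! i \<in> max_worlds M (?T \<alpha>))" for w vs
  have "\<exists>vs. chain w vs" for w
    unfolding chain_def
  proof (rule ex_greedy_chain)
    show fin\<Delta>: "finite (?\<Delta> w)" using finite_subfms[of \<phi>] by simp
    show "\<forall>\<Gamma>\<subseteq>?\<Delta> w. \<Gamma> \<noteq> {} \<longrightarrow>
      (\<exists>v\<in>{v. strictly_better M v w}. v \<in> max_worlds M (\<Union>\<alpha>\<in>\<Gamma>. ?T \<alpha>))"
    proof (intro allI impI)
      fix \<Gamma> assume \<Gamma>: "\<Gamma> \<subseteq> ?\<Delta> w" "\<Gamma> \<noteq> {}"
      then obtain \<delta> where \<delta>: "?T \<delta> = (\<Union>\<alpha>\<in>\<Gamma>. ?T \<alpha>)"
        using ex_Union_formula[OF M finite_subset[OF _ fin\<Delta>]] by blast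
      obtain u where u: "u \<in> ?T \<delta>" "strictly_better M u w" using \<Gamma> \<delta> by blast
      \<comment> \<open>Limitedness would give some maximal world; smoothness gives one that is
        \<open>u\<close> or above it, which keeps the chain above \<open>w\<close>.\<close>
      then obtain v where v: "v \<in> max_worlds M (?T \<delta>)" "v = u \<or> strictly_better M v u"
        using smooth unfolding smooth_def by blast
      then have "strictly_better M v w" using u(2) strictly_better_trans[OF tr] by blast
      then show "\<exists>v\<in>{v. strictly_better M v w}. v \<in> max_worlds M (\<Union>\<alpha>\<in>\<Gamma>. ?T \<alpha>)"
        using v(1) \<delta> by auto
    qed
  qed
  then obtain vs where "\<And>w. chain w (vs w)" by metis
  then have vs: "\<And>w. set (vs w) \<subseteq> {v. strictly_better M v w}"
    "\<And>w \<alpha>. \<alpha> \<in> ?\<Delta> w \<Longrightarrow> \<exists>i<length (vs w). vs w ! i \<in> ?T \<alpha>"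
    "\<And>w i \<alpha>. i < length (vs w) \<Longrightarrow> \<alpha> \<in> ?\<Delta> w \<Longrightarrow> vs w ! i \<in> ?T \<alpha> \<Longrightarrow>
       \<forall>j<i. vs w ! j \<notin> ?T \<alpha> \<Longrightarrow> vs w ! i \<in> max_worlds M (?T \<alpha>)"
    unfolding chain_def by blast+
  have better: "strictly_better M (vs w ! i) w" if "i < length (vs w)" for w i
    using vs(1)[of w] nth_mem[OF that] by blast
  \<comment> \<open>Smaller positions are better, and \<open>w\<close> itself sits at position
    \<open>length (vs w)\<close>; hence the non-strict bounds on positions from here on.\<close>
  define f where "f = (\<lambda>(w, i). (vs w @ [w]) ! i)"
  have f: "f (w, i) = (if i < length (vs w) then vs w ! i else w)" if "i \<le> length (vs w)" for w i
    using that by (auto simp: f_def nth_append)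
  define W where "W = Sigma R (\<lambda>w. {..length (vs w)})"
  define r where "r = {((w, i), (w, j)) | w i j. w \<in> R \<and> i < j \<and> j \<le> length (vs w)}"
  let ?N = "pullback M f W r"
  have "asym r" by (rule asymI) (auto simp: r_def)
  then have sb: "strictly_better ?N m n \<longleftrightarrow> (m, n) \<in> r" for m n
    by (simp add: strictly_better_if_asym)
  show thesis
  proof
    have "R \<noteq> {}" using R(3) M by (auto simp: preference_model_def)
    then show "preference_model ?N"
      by (intro preference_model_pullback) (auto simp: W_def r_def)
    show "finite (worlds ?N)" using R(1) by (simp add: W_def)
    show "trans (betters ?N)" by (rule transI) (auto simp: r_def)
    have "?N \<Turnstile> \<phi> \<longleftrightarrow> M \<Turnstile> \<phi>"
    proof (rule models_pullback_iff[OF M])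
      fix n assume "n \<in> W"
      then show "f n \<in> worlds M"
        using R(2) strictly_better_worlds[OF M better] by (auto simp: W_def f)
    next
      fix w assume "w \<in> worlds M"
      then obtain u where "u \<in> R" "agree ?S M u w" using R(3) by blast
      then show "\<exists>n\<in>W. agree ?S M (f n) w"
        by (intro bexI[of _ "(u, length (vs u))"]) (auto simp: W_def f)
    next
      fix \<alpha> n assume \<alpha>: "\<alpha> \<in> ?S" and n: "n \<in> max_worlds ?N {n \<in> W. f n \<in> ?T \<alpha>}"
      obtain w j where wj: "n = (w, j)" by (cases n)
      have nW: "w \<in> R" "j \<le> length (vs w)" and n\<alpha>: "f (w, j) \<in> ?T \<alpha>"
        using n by (auto simp: wj W_def max_worlds_def)
      have first: "vs w ! i \<notin> ?T \<alpha>" if "i < j" for i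
      proof
        assume "vs w ! i \<in> ?T \<alpha>"
        then have "(w, i) \<in> {n \<in> W. f n \<in> ?T \<alpha>}" using nW that by (auto simp: W_def f)
        moreover have "((w, i), n) \<in> r" using nW that by (auto simp: r_def wj)
        ultimately show False using n by (auto simp: max_worlds_def sb)
      qed
      show "f n \<in> max_worlds M (?T \<alpha>)"
      proof (cases "j < length (vs w)")
        case True
        then have "vs w ! j \<in> ?T \<alpha>" using n\<alpha> f by simp
        moreover from this have "\<alpha> \<in> ?\<Delta> w" using better[OF True] \<alpha> by blast
        ultimately show ?thesis using vs(3)[OF True] first True by (simp add: wj f)
      next
        case False
        then have j: "j = length (vs w)" using nW by simp
        \<comment> \<open>The chain of \<open>w\<close> would meet \<alpha> if \<alpha> held
          anywhere strictly above \<open>w\<close>.\<close>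
        have "\<alpha> \<notin> ?\<Delta> w" using vs(2)[of \<alpha> w] first j by blast
        then show ?thesis using n\<alpha> \<alpha> by (auto simp: wj f j max_worlds_def)
      qed
    next
      fix \<alpha> w assume \<alpha>: "\<alpha> \<in> ?S" and w: "w \<in> max_worlds M (?T \<alpha>)"
      then have "w \<in> worlds M" using max_worlds_subset[of M] truth_set_subset[OF M] by blast
      then obtain u where u: "u \<in> R" "agree ?S M u w" "u \<in> max_worlds M (?T \<alpha>)"
        using R(3) w \<alpha> by blast
      let ?n = "(u, length (vs u))"
      have "u \<in> ?T \<alpha>" using u(3) max_worlds_subset[of M] by blast
      moreover have "f m \<notin> ?T \<alpha>" if m: "(m, ?n) \<in> r" for m
      proof -
        obtain i where i: "m = (u, i)" "i < length (vs u)" using m by (auto simp: r_def)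
        then show ?thesis using better[OF i(2)] u(3) by (auto simp: f max_worlds_def)
      qed
      ultimately have "?n \<in> max_worlds ?N {n \<in> W. f n \<in> ?T \<alpha>}"
        using u(1) unfolding max_worlds_def[of ?N] sb by (auto simp: W_def f)
      then show "\<exists>n\<in>max_worlds ?N {n \<in> W. f n \<in> ?T \<alpha>}. agree ?S M (f n) w"
        using u(2) by (intro bexI[of _ ?n]) (auto simp: f)
    qed
    then show "\<not> ?N \<Turnstile> \<phi>" using neg by simp
  qed
qed

text \<open>Here the relation can simply be restricted. If \<alpha> holds at a representative,
  smoothness gives a maximal \<alpha>-world, and a representative of its type is again maximal. By
  totality, an \<alpha>-world that this representative does not strictly beat is at least as good as
  it, and by transitivity it is then maximal in M too.\<close>

lemma finite_trans_total_countermodel: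
  fixes M :: "('w, 'v) model"
  assumes M: "preference_model M" and smooth: "smooth M" and tr: "trans (betters M)"
    and tot: "total_model M" and neg: "\<not> M \<Turnstile> \<phi>"
  obtains N :: "('w, 'v) model" where
    "preference_model N" "finite (worlds N)" "trans (betters N)" "total_model N" "\<not> N \<Turnstile> \<phi>"
proof -
  let ?S = "subfms \<phi>" and ?T = "truth_set M"
  obtain R where R: "finite R" "R \<subseteq> worlds M"
    "\<And>w. w \<in> worlds M \<Longrightarrow> \<exists>u\<in>R. agree ?S M u w \<and>
       (\<forall>\<alpha>\<in>?S. u \<in> max_worlds M (?T \<alpha>) \<longleftrightarrow> w \<in> max_worlds M (?T \<alpha>))"
    using ex_representatives[OF finite_subfms] by metis
  have rep: "\<exists>u\<in>R. agree ?S M u w \<and> u \<in> max_worlds M (?T \<alpha>)"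
    if "\<alpha> \<in> ?S" "w \<in> max_worlds M (?T \<alpha>)" for \<alpha> w
  proof -
    have "w \<in> worlds M" using that max_worlds_subset[of M] truth_set_subset[OF M] by blast
    then show ?thesis using R(3) that by blast
  qed
  define r where "r = betters M \<inter> R \<times> R"
  let ?N = "pullback M id R r"
  have sb: "strictly_better ?N u v \<longleftrightarrow> strictly_better M u v" if "u \<in> R" "v \<in> R" for u v
    using that by (auto simp: strictly_better_def r_def)
  show thesis
  proof
    have "R \<noteq> {}" using R(3) M by (auto simp: preference_model_def)
    then show "preference_model ?N"
      by (intro preference_model_pullback) (auto simp: r_def)
    show "finite (worlds ?N)" using R(1) by simp
    show "trans (betters ?N)"
    proof (rule transI)
      fix a b c assume "(a, b) \<in> betters ?N" "(b, c) \<in> betters ?N"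
      then show "(a, c) \<in> betters ?N" using transD[OF tr, of a b c] by (simp add: r_def)
    qed
    show "total_model ?N" using tot R(2) by (auto simp: total_model_def r_def)
    have "?N \<Turnstile> \<phi> \<longleftrightarrow> M \<Turnstile> \<phi>"
    proof (rule models_pullback_iff[OF M])
      fix n assume "n \<in> R" then show "id n \<in> worlds M" using R(2) by auto
    next
      fix w assume "w \<in> worlds M"
      then show "\<exists>n\<in>R. agree ?S M (id n) w" using R(3) by auto
    next
      fix \<alpha> n assume \<alpha>: "\<alpha> \<in> ?S" and n: "n \<in> max_worlds ?N {n \<in> R. id n \<in> ?T \<alpha>}"
      then have nR: "n \<in> R" and n\<alpha>: "n \<in> ?T \<alpha>" by (auto simp: max_worlds_def)
      then obtain v where "v \<in> max_worlds M (?T \<alpha>)" using smooth unfolding smooth_def by blast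
      then obtain u where u: "u \<in> R" "u \<in> max_worlds M (?T \<alpha>)" using rep[OF \<alpha>] by blast
      then have "u \<in> ?T \<alpha>" using max_worlds_subset[of M] by blast
      then have "\<not> strictly_better M u n" using n sb[OF u(1) nR] u(1) by (auto simp: max_worlds_def)
      then have nu: "(n, u) \<in> betters M"
        using tot u(1) nR R(2) unfolding total_model_def strictly_better_def by blast
      have "\<not> strictly_better M x n" if x: "x \<in> ?T \<alpha>" for x
      proof
        assume "strictly_better M x n"
        then have "strictly_better M x u"
          using nu transD[OF tr] unfolding strictly_better_def by blast
        then show False using u(2) x by (auto simp: max_worlds_def)
      qed
      then show "id n \<in> max_worlds M (?T \<alpha>)" using n\<alpha> by (auto simp: max_worlds_def)
    next
      fix \<alpha> w assume "\<alpha> \<in> ?S" "w \<in> max_worlds M (?T \<alpha>)"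
      then obtain u where u: "u \<in> R" "agree ?S M u w" "u \<in> max_worlds M (?T \<alpha>)"
        using rep by blast
      then have "u \<in> max_worlds ?N {n \<in> R. id n \<in> ?T \<alpha>}"
        using sb by (auto simp: max_worlds_def)
      then show "\<exists>n\<in>max_worlds ?N {n \<in> R. id n \<in> ?T \<alpha>}. agree ?S M (id n) w"
        using u(2) by auto
    qed
    then show "\<not> ?N \<Turnstile> \<phi>" using neg by simp
  qed
qed

section \<open>Finite models and theoremhood over arbitrary infinite types\<close>

text \<open>From left to right, a finite model is copied into \<open>'w\<close>, where acyclicity
  makes it limited and transitivity makes it smooth. From right to left, a countermodel over
  \<open>'w\<close> yields a finite one, which is copied into \<open>'u\<close>. As the two types
  vary independently, theoremhood does not depend on the infinite type that supplies the
  worlds.\<close>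

theorem theorem4p2:
  fixes \<phi> :: "'v fm"
  shows
    "(theorem_E TYPE('w::infinite) \<phi> \<longleftrightarrow>
       (\<forall>M :: ('u::infinite, 'v) model.
          preference_model M \<and> finite (worlds M) \<longrightarrow> M \<Turnstile> \<phi>)) \<and>
     (theorem_F TYPE('w) \<phi> \<longleftrightarrow>
       (\<forall>M :: ('u, 'v) model.
          preference_model M \<and> finite (worlds M) \<and> acyclic (betters M) \<longrightarrow> M \<Turnstile> \<phi>)) \<and>
     (theorem_F_CM TYPE('w) \<phi> \<longleftrightarrow>
       (\<forall>M :: ('u, 'v) model.
          preference_model M \<and> finite (worlds M) \<and> trans (betters M) \<longrightarrow> M \<Turnstile> \<phi>)) \<and>
     (theorem_G TYPE('w) \<phi> \<longleftrightarrow>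
       (\<forall>M :: ('u, 'v) model.
          preference_model M \<and> finite (worlds M) \<and> trans (betters M) \<and> total_model M
            \<longrightarrow> M \<Turnstile> \<phi>))"
proof (intro conjI iffI allI impI; (elim conjE)?)
  fix M :: "('u, 'v) model"
  assume "theorem_E TYPE('w) \<phi>" and M: "preference_model M" "finite (worlds M)"
  moreover obtain N :: "('w, 'v) model" where "preference_model N" "N \<Turnstile> \<phi> \<longleftrightarrow> M \<Turnstile> \<phi>"
    using ex_finite_copy[OF M] by metis
  ultimately show "M \<Turnstile> \<phi>" unfolding theorem_E_def by blast
next
  assume *: "\<forall>M :: ('u, 'v) model. preference_model M \<and> finite (worlds M) \<longrightarrow> M \<Turnstile> \<phi>"
  show "theorem_E TYPE('w) \<phi>"
    unfolding theorem_E_def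
  proof (intro allI impI; rule ccontr)
    fix M :: "('w, 'v) model"
    assume "preference_model M" "\<not> M \<Turnstile> \<phi>"
    then obtain N :: "('w \<times> nat, 'v) model" where
      N: "preference_model N" "finite (worlds N)" "\<not> N \<Turnstile> \<phi>"
      by (rule finite_countermodel)
    obtain N' :: "('u, 'v) model" where
      "preference_model N'" "finite (worlds N')" "N' \<Turnstile> \<phi> \<longleftrightarrow> N \<Turnstile> \<phi>"
      using ex_finite_copy[OF N(1,2)] by metis
    then show False using * N(3) by blast
  qed
next
  fix M :: "('u, 'v) model"
  assume valid: "theorem_F TYPE('w) \<phi>"
    and M: "preference_model M" "finite (worlds M)" and ac: "acyclic (betters M)"
  obtain N :: "('w, 'v) model" where N: "preference_model N" "finite (worlds N)"
    "acyclic (betters N)" "N \<Turnstile> \<phi> \<longleftrightarrow> M \<Turnstile> \<phi>"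
    using ex_finite_copy[OF M] ac by metis
  then show "M \<Turnstile> \<phi>" using valid limited_if_finite_acyclic unfolding theorem_F_def by blast
next
  assume *: "\<forall>M :: ('u, 'v) model.
    preference_model M \<and> finite (worlds M) \<and> acyclic (betters M) \<longrightarrow> M \<Turnstile> \<phi>"
  show "theorem_F TYPE('w) \<phi>"
    unfolding theorem_F_def
  proof (intro allI impI; elim conjE; rule ccontr)
    fix M :: "('w, 'v) model"
    assume "preference_model M" "limited M" "\<not> M \<Turnstile> \<phi>"
    then obtain N :: "(('w, 'v) layered, 'v) model" where
      N: "preference_model N" "finite (worlds N)" "acyclic (betters N)" "\<not> N \<Turnstile> \<phi>"
      by (rule finite_acyclic_countermodel)
    obtain N' :: "('u, 'v) model" where "preference_model N'" "finite (worlds N')"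
      "acyclic (betters N')" "N' \<Turnstile> \<phi> \<longleftrightarrow> N \<Turnstile> \<phi>"
      using ex_finite_copy[OF N(1,2)] N(3) by metis
    then show False using * N(4) by blast
  qed
next
  fix M :: "('u, 'v) model"
  assume valid: "theorem_F_CM TYPE('w) \<phi>"
    and M: "preference_model M" "finite (worlds M)" and tr: "trans (betters M)"
  obtain N :: "('w, 'v) model" where N: "preference_model N" "finite (worlds N)"
    "trans (betters N)" "N \<Turnstile> \<phi> \<longleftrightarrow> M \<Turnstile> \<phi>"
    using ex_finite_copy[OF M] tr by metis
  then show "M \<Turnstile> \<phi>" using valid smooth_if_finite_trans unfolding theorem_F_CM_def by blast
next
  assume *: "\<forall>M :: ('u, 'v) model.
    preference_model M \<and> finite (worlds M) \<and> trans (betters M) \<longrightarrow> M \<Turnstile> \<phi>"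
  show "theorem_F_CM TYPE('w) \<phi>"
    unfolding theorem_F_CM_def
  proof (intro allI impI; elim conjE; rule ccontr)
    fix M :: "('w, 'v) model"
    assume "preference_model M" "smooth M" "trans (betters M)" "\<not> M \<Turnstile> \<phi>"
    then obtain N :: "('w \<times> nat, 'v) model" where
      N: "preference_model N" "finite (worlds N)" "trans (betters N)" "\<not> N \<Turnstile> \<phi>"
      by (rule finite_trans_countermodel)
    obtain N' :: "('u, 'v) model" where "preference_model N'" "finite (worlds N')"
      "trans (betters N')" "N' \<Turnstile> \<phi> \<longleftrightarrow> N \<Turnstile> \<phi>"
      using ex_finite_copy[OF N(1,2)] N(3) by metis
    then show False using * N(4) by blast
  qed
next
  fix M :: "('u, 'v) model"
  assume valid: "theorem_G TYPE('w) \<phi>"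
    and M: "preference_model M" "finite (worlds M)" and tr: "trans (betters M)" "total_model M"
  obtain N :: "('w, 'v) model" where N: "preference_model N" "finite (worlds N)"
    "trans (betters N)" "total_model N" "N \<Turnstile> \<phi> \<longleftrightarrow> M \<Turnstile> \<phi>"
    using ex_finite_copy[OF M] tr by metis
  then show "M \<Turnstile> \<phi>" using valid smooth_if_finite_trans unfolding theorem_G_def by blast
next
  assume *: "\<forall>M :: ('u, 'v) model.
    preference_model M \<and> finite (worlds M) \<and> trans (betters M) \<and> total_model M \<longrightarrow> M \<Turnstile> \<phi>"
  show "theorem_G TYPE('w) \<phi>"
    unfolding theorem_G_def
  proof (intro allI impI; elim conjE; rule ccontr)
    fix M :: "('w, 'v) model"
    assume "preference_model M" "smooth M" "trans (betters M)" "total_model M" "\<not> M \<Turnstile> \<phi>"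
    then obtain N :: "('w, 'v) model" where N: "preference_model N" "finite (worlds N)"
      "trans (betters N)" "total_model N" "\<not> N \<Turnstile> \<phi>"
      by (rule finite_trans_total_countermodel)
    obtain N' :: "('u, 'v) model" where "preference_model N'" "finite (worlds N')"
      "trans (betters N')" "total_model N'" "N' \<Turnstile> \<phi> \<longleftrightarrow> N \<Turnstile> \<phi>"
      using ex_finite_copy[OF N(1,2)] N(3,4) by metis
    then show False using * N(5) by blast
  qed
qed

end
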